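(* Let $n\ge 1$ and $m\ge 1$ be integers and let $p>2n+1$ be a prime. Then the linear combination of modified binomial coefficients $$\sum_{j=0}^{n} (-1)^j\binom{2n+1}{j}\frac{2(n-j)+1}{2n+1}\cdot \binom{(n+1-j)m}{m}_p$$ is divisible by $p^{(2n+1)\nu_p(m)}$.
   Context: For a prime $p$ and a nonnegative integer $A$, the modified factorial is $A!_p=\prod_{1\le k\le A,\ p\nmid k} k$, and for integers $0\le B\le A$ the modified binomial coefficient is $\binom{A}{B}_p=\frac{A!_p}{B!_p\,(A-B)!_p}$ (an integer). $\nu_p(x)$ denotes the $p$-adic valuation of $x$ (the exponent of the largest power of $p$ dividing $x$). The coefficients $\binom{2n+1}{j}\frac{2(n-j)+1}{2n+1}=\binom{2n}{j}-\binom{2n}{j-1}$ are integers.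
   Formalization: Modified binomial coefficients need not be integers (for p=5, that of 20 over 10 is 92378/3), so "divisible" is read as divisibility among rationals with denominator prime to p; it agrees with ordinary divisibility when the sum is an integer. *)

theory Defs
  imports Complex_Main "HOL-Computational_Algebra.Primes"
begin

definition mod_fact :: "nat \<Rightarrow> nat \<Rightarrow> nat" where
  "mod_fact p A = (\<Prod>k | 1 \<le> k \<and> k \<le> A \<and> \<not> p dvd k. k)"

text \<open>The quotient is taken in the rationals: it is always a \<open>p\<close>-adic unit, but it need not be
  an integer (see \<open>mod_binom_not_integer\<close> below). It is meant for \<open>B \<le> A\<close> only.\<close>

definition mod_binom :: "nat \<Rightarrow> nat \<Rightarrow> nat \<Rightarrow> rat" where
  "mod_binom p A B = of_nat (mod_fact p A) / (of_nat (mod_fact p B) * of_nat (mod_fact p (A - B)))"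

text \<open>The localization of the integers at the prime ideal \<open>(p)\<close>, as a subring of the rationals.\<close>

definition p_integers :: "nat \<Rightarrow> rat set" where
  "p_integers p = {of_int a / of_int b | a b. \<not> int p dvd b}"

text \<open>Divisibility in that subring. On integers it agrees with ordinary divisibility by powers
  of \<open>p\<close> (see \<open>p_dvd_of_int_iff\<close>).\<close>

definition p_dvd :: "nat \<Rightarrow> rat \<Rightarrow> rat \<Rightarrow> bool" where
  "p_dvd p d x \<longleftrightarrow> (\<exists>c \<in> p_integers p. x = d * c)"

lemma p_dvd_of_int_iff:
  assumes "prime p"
  shows "p_dvd p (of_nat (p ^ k)) (of_int x) \<longleftrightarrow> int (p ^ k) dvd x"
proof
  assume "p_dvd p (of_nat (p ^ k)) (of_int x)"
  then obtain a b where b: "\<not> int p dvd b"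
    and eq: "(of_int x :: rat) = of_nat (p ^ k) * (of_int a / of_int b)"
    unfolding p_dvd_def p_integers_def by blast
  have "b \<noteq> 0" using b by auto
  with eq have "(of_int (x * b) :: rat) = of_int (int (p ^ k) * a)"
    by (simp add: field_simps)
  then have "x * b = int (p ^ k) * a" by (simp only: of_int_eq_iff)
  then have "int (p ^ k) dvd x * b" by simp
  moreover have "coprime (int (p ^ k)) b"
    using assms b by (simp add: prime_imp_coprime)
  ultimately show "int (p ^ k) dvd x" by (simp add: coprime_dvd_mult_left_iff)
next
  assume "int (p ^ k) dvd x"
  then obtain y where "x = int (p ^ k) * y" by (auto elim: dvdE)
  moreover have "(of_int y :: rat) \<in> p_integers p"
    unfolding p_integers_def mem_Collect_eq
    using assms by (intro exI[of _ y] exI[of _ 1]) (simp add: prime_nat_iff)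
  ultimately show "p_dvd p (of_nat (p ^ k)) (of_int x)"
    unfolding p_dvd_def by (intro bexI[of _ "of_int y"]) simp_all
qed

lemma mod_fact_0: "mod_fact p 0 = 1"
proof -
  have "{k. 1 \<le> k \<and> k \<le> 0 \<and> \<not> p dvd k} = {}" by auto
  then show ?thesis by (simp only: mod_fact_def prod.empty)
qed

lemma mod_fact_Suc:
  "mod_fact p (Suc A) = (if p dvd Suc A then mod_fact p A else Suc A * mod_fact p A)"
proof -
  have "{k. 1 \<le> k \<and> k \<le> Suc A \<and> \<not> p dvd k} =
    (if p dvd Suc A then {k. 1 \<le> k \<and> k \<le> A \<and> \<not> p dvd k}
     else insert (Suc A) {k. 1 \<le> k \<and> k \<le> A \<and> \<not> p dvd k})"
    by (auto simp: le_Suc_eq)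
  then show ?thesis by (simp add: mod_fact_def)
qed

lemma mod_fact_numeral:
  "mod_fact p (numeral A) = (if p dvd numeral A then mod_fact p (pred_numeral A)
     else numeral A * mod_fact p (pred_numeral A))"
  using mod_fact_Suc[of p "pred_numeral A"] by (simp add: numeral_eq_Suc)

lemma mod_binom_not_integer: "mod_binom 5 20 10 \<notin> \<int>"
proof
  have "mod_binom 5 20 10 = 92378 / 3"
    by (simp add: mod_binom_def mod_fact_numeral mod_fact_0 mod_fact_Suc)
  moreover assume "mod_binom 5 20 10 \<in> \<int>"
  ultimately obtain z :: int where "(92378 / 3 :: rat) = of_int z" by (auto elim: Ints_cases)
  then have "(of_int 92378 :: rat) = of_int (3 * z)" by (simp add: field_simps)
  then have "92378 = 3 * z" by (simp only: of_int_eq_iff)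
  then show False by presburger
qed

end

theory Submission
  imports Defs "HOL-Computational_Algebra.Polynomial" "HOL-Number_Theory.Residue_Primitive_Roots"
begin

text \<open>
  The case \<open>p\<close> not dividing \<open>m\<close> only asks for \<open>p\<close>-integrality. Otherwise let \<open>Q(x)\<close> be the product of
  \<open>x + i\<close> over all \<open>i \<le> m\<close> prime to \<open>p\<close>, so that the modified binomial coefficient of \<open>(t + 1) m\<close>
  over \<open>m\<close> is \<open>Q(t m) / Q(0)\<close>. The substitution \<open>i \<mapsto> m - i\<close> shows that \<open>Q(t m)\<close> is invariant under
  \<open>t \<mapsto> - 1 - t\<close>, which makes the sum, up to a \<open>p\<close>-adic unit, the full \<open>(2 n + 1)\<close>-st finite
  difference of \<open>(2 t + 1) Q(t m)\<close>. That difference kills all powers of \<open>t\<close> below \<open>2 n + 1\<close>. The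
  surviving terms carry \<open>m ^ (2 n + 1)\<close>, except for one that carries \<open>m ^ (2 n)\<close> times the
  coefficient of \<open>x ^ (2 n)\<close> in \<open>Q\<close>. This coefficient is divisible by the \<open>p\<close>-part of \<open>m\<close>: multiplying
  the roots by some \<open>g\<close> prime to \<open>m\<close> permutes them modulo \<open>m\<close>, and \<open>g\<close> can be chosen as a primitive
  root modulo \<open>p\<close>, where \<open>2 n < p - 1\<close>.
\<close>

section \<open>Finite differences of powers\<close>

lemma alternating_binomial_power_sum_eq_0:
  fixes a :: "'a :: comm_ring_1"
  assumes "k < N"
  shows "(\<Sum>j\<le>N. (- 1) ^ j * of_nat (N choose j) * (a - of_nat j) ^ k) = 0"
  using assms
proof (induction k arbitrary: N a)
  case 0
  then show ?case using choose_alternating_sum[of N, where 'a = 'a] by simp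
next
  case (Suc k)
  obtain M where N: "N = Suc M" and M: "k < M"
    using Suc.prems by (cases N) auto
  \<comment> \<open>One factor \<open>a - of_nat j\<close> is split off. In the part with
    \<open>j\<close>, absorption lowers \<open>N\<close> to \<open>M\<close> and the index shift
    turns \<open>a\<close> into \<open>a - 1\<close>, so the induction must vary both.\<close>
  have "(\<Sum>j\<le>N. (- 1) ^ j * of_nat (N choose j) * (a - of_nat j) ^ Suc k) =
      a * (\<Sum>j\<le>N. (- 1) ^ j * of_nat (N choose j) * (a - of_nat j) ^ k)
      - (\<Sum>j\<le>N. (- 1) ^ j * of_nat (j * (N choose j)) * (a - of_nat j) ^ k)"
    by (simp add: sum_distrib_left sum_subtractf[symmetric] algebra_simps)
  also have "(\<Sum>j\<le>N. (- 1) ^ j * of_nat (N choose j) * (a - of_nat j) ^ k) = 0"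
    using Suc.IH[of N a] M N by simp
  also have "(\<Sum>j\<le>N. (- 1) ^ j * of_nat (j * (N choose j)) * (a - of_nat j) ^ k) =
      (\<Sum>j\<le>M. (- 1) ^ Suc j * of_nat (Suc j * (N choose Suc j)) * (a - of_nat (Suc j)) ^ k)"
    unfolding N by (subst sum.atMost_Suc_shift) simp
  also have "\<dots> = (\<Sum>j\<le>M. - of_nat N * ((- 1) ^ j * of_nat (M choose j) * ((a - 1) - of_nat j) ^ k))"
  proof (intro sum.cong refl)
    fix j
    have e: "Suc j * (N choose Suc j) = N * (M choose j)"
      using binomial_absorption[of j N] N by simp
    have d: "a - of_nat (Suc j) = (a - 1) - of_nat j" by simp
    show "(- 1) ^ Suc j * of_nat (Suc j * (N choose Suc j)) * (a - of_nat (Suc j)) ^ k =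
        - of_nat N * ((- 1) ^ j * of_nat (M choose j) * ((a - 1) - of_nat j) ^ k)"
      unfolding e d of_nat_mult by (simp only: power_Suc mult_ac mult_minus_left mult_minus_right mult_1_left)
  qed
  also have "\<dots> = 0"
    unfolding sum_distrib_left[symmetric] using Suc.IH[OF M, of "a - 1"] by simp
  finally show ?case by simp
qed

text \<open>The factors are exchanged one at a time. The ring is general because the use is for
  integer polynomials modulo the constant \<open>m\<close>.\<close>

lemma dvd_prod_diff:
  fixes f h :: "'b \<Rightarrow> 'a :: comm_ring_1"
  assumes "\<And>i. i \<in> A \<Longrightarrow> d dvd f i - h i"
  shows "d dvd prod f A - prod h A"
  using assms
proof (induction A rule: infinite_finite_induct)
  case (insert x A)
  have "prod f (insert x A) - prod h (insert x A) =
      (f x - h x) * prod f A + h x * (prod f A - prod h A)"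
    using insert.hyps by (simp add: algebra_simps)
  then show ?case using insert by (simp add: dvd_add)
qed simp_all

section \<open>Residues prime to \<open>p\<close> and their product polynomial\<close>

definition p_units :: "nat \<Rightarrow> nat \<Rightarrow> nat set" where
  "p_units p m = {k. 1 \<le> k \<and> k \<le> m \<and> \<not> p dvd k}"

definition p_units_poly :: "nat \<Rightarrow> nat \<Rightarrow> int poly" where
  "p_units_poly p m = (\<Prod>i\<in>p_units p m. [:int i, 1:])"

lemma finite_p_units [simp]: "finite (p_units p m)"
  by (rule finite_subset[of _ "{..m}"]) (auto simp: p_units_def)

lemma mod_fact_eq_prod_p_units: "mod_fact p m = \<Prod>(p_units p m)"
  by (simp add: mod_fact_def p_units_def)

lemma p_units_less: "p dvd m \<Longrightarrow> i \<in> p_units p m \<Longrightarrow> i < m"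
  by (cases "i = m") (auto simp: p_units_def)

lemma poly_p_units_poly: "poly (p_units_poly p m) x = (\<Prod>i\<in>p_units p m. int i + x)"
  by (simp add: p_units_poly_def poly_prod)

text \<open>The count is the degree of \<open>p_units_poly p m\<close>. Its factor
  \<open>p - 1\<close> serves twice: for the parity in the reflection and for Fermat's
  theorem.\<close>

lemma card_p_units:
  assumes "p dvd m" "p > 0"
  shows "card (p_units p m) = (m div p) * (p - 1)"
proof -
  have m: "m = p * (m div p)" using assms by simp
  have mult: "{k. 1 \<le> k \<and> k \<le> m \<and> p dvd k} = (*) p ` {1..m div p}" (is "?L = ?R")
  proof (intro equalityI subsetI)
    fix k assume k: "k \<in> ?L"
    then obtain q where q: "k = p * q" by auto
    have "q \<le> m div p" using k q assms m by (metis (mono_tags) mem_Collect_eq div_le_mono nonzero_mult_div_cancel_left not_gr_zero)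
    then show "k \<in> ?R" using k q by (auto simp: Suc_le_eq)
  next
    fix k assume "k \<in> ?R"
    then obtain q where q: "k = p * q" "1 \<le> q" "q \<le> m div p" by (metis atLeastAtMost_iff imageE)
    then have "k \<le> m" using m by (metis mult_le_mono2)
    then show "k \<in> ?L" using q assms by (auto simp: Suc_le_eq)
  qed
  have "card ?L = m div p"
    unfolding mult using assms by (subst card_image) (auto simp: inj_on_def)
  moreover have "p_units p m = {1..m} - ?L" by (auto simp: p_units_def)
  moreover have "card ({1..m} - ?L) = card {1..m} - card ?L"
    by (intro card_Diff_subset) (auto intro: finite_subset[of _ "{..m}"])
  ultimately show ?thesis using m
    by (simp add: diff_mult_distrib2 mult.commute)
qed

lemma even_card_p_units:
  assumes "p dvd m" "odd p"
  shows "even (card (p_units p m))"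
proof -
  have "p > 0" using assms(2) by (cases p) auto
  then show ?thesis using assms card_p_units[of p m] by simp
qed

text \<open>Replacing \<open>i\<close> by \<open>m - i\<close> negates every factor, and the number
  of factors is even. At \<open>x = t * m\<close> this is the symmetry
  \<open>t \<mapsto> - 1 - t\<close>.\<close>

lemma poly_p_units_poly_reflect:
  assumes "p dvd m" "odd p"
  shows "poly (p_units_poly p m) (- x - int m) = poly (p_units_poly p m) x"
proof -
  have bij: "bij_betw (\<lambda>i. m - i) (p_units p m) (p_units p m)"
  proof (rule bij_betwI[where g = "\<lambda>i. m - i"])
    show "(\<lambda>i. m - i) \<in> p_units p m \<rightarrow> p_units p m"
    proof
      fix i assume i: "i \<in> p_units p m"
      have "i < m" using p_units_less[OF assms(1) i] .
      moreover have "\<not> p dvd m - i"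
        using i assms(1) \<open>i < m\<close> unfolding p_units_def
        by (metis (mono_tags, lifting) dvd_diffD1 less_imp_le_nat mem_Collect_eq)
      ultimately show "m - i \<in> p_units p m" by (auto simp: p_units_def)
    qed
    then show "(\<lambda>i. m - i) \<in> p_units p m \<rightarrow> p_units p m" .
  qed (auto simp: p_units_def)
  have "poly (p_units_poly p m) (- x - int m) = (\<Prod>i\<in>p_units p m. int i + (- x - int m))"
    by (rule poly_p_units_poly)
  also have "\<dots> = (\<Prod>i\<in>p_units p m. (- 1) * (int (m - i) + x))"
    by (intro prod.cong refl) (auto simp: p_units_def of_nat_diff)
  also have "\<dots> = (- 1) ^ card (p_units p m) * (\<Prod>i\<in>p_units p m. int (m - i) + x)"
    by (simp only: prod.distrib prod_constant)
  also have "(- 1 :: int) ^ card (p_units p m) = 1" using even_card_p_units[OF assms] by simp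
  also have "(\<Prod>i\<in>p_units p m. int (m - i) + x) = (\<Prod>i\<in>p_units p m. int i + x)"
    by (rule prod.reindex_bij_betw[OF bij])
  finally show ?thesis by (simp add: poly_p_units_poly)
qed

section \<open>Coefficients modulo the \<open>p\<close>-part of \<open>m\<close>\<close>

lemma bij_betw_mult_mod_p_units:
  assumes "p dvd m" "coprime g m" "m > 0"
  shows "bij_betw (\<lambda>i. (g * i) mod m) (p_units p m) (p_units p m)"
proof -
  have gp: "p dvd g * i \<longleftrightarrow> p dvd i" for i
  proof -
    have "coprime p g" using assms by (metis coprime_commute coprime_divisors dvd_refl)
    then show ?thesis by (simp add: coprime_dvd_mult_right_iff)
  qed
  have inj: "inj_on (\<lambda>i. (g * i) mod m) (p_units p m)"
  proof (rule inj_onI)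
    fix i j assume ij: "i \<in> p_units p m" "j \<in> p_units p m" "(g * i) mod m = (g * j) mod m"
    then have "[g * i = g * j] (mod m)" by (simp add: cong_def)
    then have "[i = j] (mod m)" using assms(2) by (simp add: cong_mult_lcancel_nat)
    then show "i = j" using p_units_less[OF assms(1)] ij by (simp add: cong_def)
  qed
  moreover have "(\<lambda>i. (g * i) mod m) ` p_units p m \<subseteq> p_units p m"
  proof (rule image_subsetI)
    fix i assume i: "i \<in> p_units p m"
    have nd: "\<not> p dvd (g * i) mod m"
      using i assms(1) gp by (auto simp: p_units_def dvd_mod_iff)
    then have "(g * i) mod m \<noteq> 0" by (metis dvd_0_right)
    moreover have "(g * i) mod m \<le> m" using assms(3) by (simp add: less_imp_le)
    ultimately show "(g * i) mod m \<in> p_units p m" using nd by (simp add: p_units_def)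
  qed
  ultimately show ?thesis
    unfolding bij_betw_def using endo_inj_surj[OF finite_p_units] by blast
qed

text \<open>Substituting \<open>g * x\<close> for \<open>x\<close> gives factors
  \<open>i + g * x\<close>; scaling by \<open>g ^ card (p_units p m)\<close> gives
  \<open>g * i + g * x\<close>. Since \<open>g\<close> permutes the residues modulo
  \<open>m\<close>, the products agree modulo \<open>m\<close>, and the coefficients of
  \<open>x ^ k\<close> are compared.\<close>

lemma dvd_coeff_p_units_poly_scaled:
  assumes "p dvd m" "coprime g m" "m > 0"
  shows "int m dvd (int g ^ k - int g ^ card (p_units p m)) * Polynomial.coeff (p_units_poly p m) k"
proof -
  let ?U = "p_units p m"
  have "pcompose (p_units_poly p m) [:0, int g:] = (\<Prod>i\<in>?U. [:int i, int g:])"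
    by (simp add: p_units_poly_def pcompose_prod pcompose_pCons)
  also have "\<dots> = (\<Prod>i\<in>?U. [:int ((g * i) mod m), int g:])"
    by (rule prod.reindex_bij_betw[OF bij_betw_mult_mod_p_units[OF assms], symmetric])
  finally have 1: "pcompose (p_units_poly p m) [:0, int g:] = \<dots>" .
  have 2: "Polynomial.smult (int g ^ card ?U) (p_units_poly p m) = (\<Prod>i\<in>?U. [:int (g * i), int g:])"
    using prod_smult[of "\<lambda>_. int g" "\<lambda>i. [:int i, 1:]" ?U] by (simp add: p_units_poly_def)
  have "[:int m:] dvd (\<Prod>i\<in>?U. [:int ((g * i) mod m), int g:]) - (\<Prod>i\<in>?U. [:int (g * i), int g:])"
  proof (rule dvd_prod_diff)
    fix i
    have "int m dvd int ((g * i) mod m) - int (g * i)"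
      by (simp add: zmod_int mod_eq_dvd_iff[symmetric])
    then show "[:int m:] dvd [:int ((g * i) mod m), int g:] - [:int (g * i), int g:]"
      by (auto simp: const_poly_dvd_iff coeff_pCons split: nat.split)
  qed
  then have "int m dvd Polynomial.coeff (pcompose (p_units_poly p m) [:0, int g:]
      - Polynomial.smult (int g ^ card ?U) (p_units_poly p m)) k"
    unfolding 1 2 const_poly_dvd_iff by blast
  then show ?thesis by (simp add: coeff_pcompose_linear algebra_simps)
qed

text \<open>A primitive root \<open>r\<close> has order \<open>p - 1 > k\<close>. The Chinese
  remainder theorem replaces it by a \<open>g\<close> that is 1 modulo the part \<open>m'\<close> of
  \<open>m\<close> prime to \<open>p\<close>, which makes \<open>g\<close> coprime to all of
  \<open>m\<close>.\<close>

lemma exists_coprime_power_not_cong_1: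
  assumes "prime p" "m > 0" "0 < k" "k < p - 1"
  obtains g where "coprime g m" "\<not> p dvd g" "\<not> [g ^ k = 1] (mod p)"
proof -
  obtain r where r: "residue_primroot p r"
    using prime_primitive_root_exists[of p] assms(1) prime_gt_1_nat by auto
  then have "coprime p r" and ord: "ord p r = p - 1"
    using assms(1) by (auto simp: residue_primroot_def totient_prime)
  obtain m' where m': "m = p ^ multiplicity p m * m'" "\<not> p dvd m'"
    using multiplicity_decompose'[of m p] assms(1,2) by (metis not_prime_unit not_gr_zero)
  have "coprime p m'" using m'(2) assms(1) by (simp add: prime_imp_coprime)
  then obtain g where g: "[g = r] (mod p)" "[g = 1] (mod m')"
    using binary_chinese_remainder_nat[of p m' r 1] by blast
  have gp: "coprime g p" using g(1) \<open>coprime p r\<close>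
    by (metis cong_imp_coprime cong_sym coprime_commute)
  have gm: "coprime g m'" using g(2) by (metis cong_imp_coprime cong_sym coprime_1_left)
  have "coprime g m" by (subst m'(1)) (use gp gm in simp)
  moreover have "\<not> p dvd g" using gp assms(1)
    by (metis coprime_absorb_right not_prime_unit)
  moreover have "\<not> [g ^ k = 1] (mod p)"
  proof
    assume "[g ^ k = 1] (mod p)"
    then have "[r ^ k = 1] (mod p)" using g(1) by (meson cong_pow cong_sym cong_trans)
    then have "p - 1 dvd k" using ord ord_divides by metis
    then show False using assms by (simp add: nat_dvd_not_less)
  qed
  ultimately show ?thesis using that by blast
qed

text \<open>By Fermat, the difference of powers in \<open>dvd_coeff_p_units_poly_scaled\<close> is
  \<open>g ^ k - 1\<close> modulo \<open>p\<close>. The choice of \<open>g\<close> makes it prime to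
  \<open>p\<close>, so it cancels.\<close>

lemma prime_power_dvd_coeff_p_units_poly:
  assumes "prime p" "p dvd m" "m > 0" "0 < k" "k < p - 1"
  shows "int (p ^ multiplicity p m) dvd Polynomial.coeff (p_units_poly p m) k"
proof -
  obtain g where g: "coprime g m" "\<not> p dvd g" "\<not> [g ^ k = 1] (mod p)"
    using exists_coprime_power_not_cong_1[OF assms(1,3-5)] .
  let ?d = "int g ^ k - int g ^ card (p_units p m)"
  have "[g ^ (p - 1) = 1] (mod p)" using fermat_theorem[OF assms(1) g(2)] .
  then have "[(g ^ (p - 1)) ^ (m div p) = 1 ^ (m div p)] (mod p)" by (rule cong_pow)
  then have one: "[g ^ card (p_units p m) = 1] (mod p)"
    using card_p_units[OF assms(2)] assms(1)
    by (simp add: power_mult[symmetric] mult.commute prime_gt_0_nat)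
  have "\<not> int p dvd ?d"
  proof
    assume "int p dvd ?d"
    then have "[int (g ^ k) = int (g ^ card (p_units p m))] (mod int p)"
      by (simp add: cong_iff_dvd_diff)
    then have "[g ^ k = g ^ card (p_units p m)] (mod p)" by (simp only: cong_int_iff)
    with one g(3) show False using cong_trans by blast
  qed
  then have "coprime (int (p ^ multiplicity p m)) ?d"
    using assms(1) by (simp add: prime_imp_coprime)
  moreover have "int (p ^ multiplicity p m) dvd int m"
    unfolding int_dvd_int_iff by (rule multiplicity_dvd)
  then have "int (p ^ multiplicity p m) dvd ?d * Polynomial.coeff (p_units_poly p m) k"
    using dvd_coeff_p_units_poly_scaled[OF assms(2) g(1) assms(3)] dvd_trans by blast
  ultimately show ?thesis by (simp add: coprime_dvd_mult_right_iff)
qed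

section \<open>Modified binomial coefficients as polynomial values\<close>

lemma mod_fact_add_multiple:
  assumes "p dvd c"
  shows "mod_fact p (c + m) = mod_fact p c * (\<Prod>i\<in>p_units p m. c + i)"
proof -
  \<comment> \<open>Translation by \<open>c\<close>, a multiple of \<open>p\<close>, preserves being
    prime to \<open>p\<close>.\<close>
  have "p_units p (c + m) = p_units p c \<union> (+) c ` p_units p m"
  proof (intro equalityI subsetI)
    fix k assume k: "k \<in> p_units p (c + m)"
    show "k \<in> p_units p c \<union> (+) c ` p_units p m"
    proof (cases "k \<le> c")
      case False
      then have "k = c + (k - c)" "k - c \<in> p_units p m"
        using k assms by (auto simp: p_units_def dvd_diff_nat dest: dvd_diffD)
      then show ?thesis by blast
    qed (use k in \<open>auto simp: p_units_def\<close>)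
  qed (use assms in \<open>auto simp: p_units_def dvd_add_right_iff\<close>)
  moreover have "p_units p c \<inter> (+) c ` p_units p m = {}" by (auto simp: p_units_def)
  ultimately show ?thesis
    by (simp add: mod_fact_eq_prod_p_units prod.union_disjoint prod.reindex)
qed

lemma mod_fact_pos: "mod_fact p m > 0"
  unfolding mod_fact_eq_prod_p_units by (rule prod_pos) (auto simp: p_units_def)

lemma not_dvd_mod_fact:
  assumes "prime p"
  shows "\<not> p dvd mod_fact p m"
  using assms by (auto simp: mod_fact_eq_prod_p_units prime_dvd_prod_iff p_units_def)

text \<open>The modified factorial of \<open>t * m\<close> in the denominator cancels the factors up
  to \<open>t * m\<close> in the numerator; those left are \<open>t * m + i\<close>.\<close>

lemma mod_binom_eq_poly:
  assumes "p dvd m"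
  shows "mod_binom p ((t + 1) * m) m =
    of_int (poly (p_units_poly p m) (int t * int m)) / of_nat (mod_fact p m)"
proof -
  have "mod_fact p ((t + 1) * m) = mod_fact p (t * m) * (\<Prod>i\<in>p_units p m. t * m + i)"
    using mod_fact_add_multiple[of p "t * m" m] assms by (simp add: add.commute)
  moreover have "poly (p_units_poly p m) (int t * int m) = int (\<Prod>i\<in>p_units p m. t * m + i)"
    by (simp add: poly_p_units_poly add.commute)
  moreover have "(t + 1) * m - m = t * m" by simp
  ultimately show ?thesis
    unfolding mod_binom_def using mod_fact_pos[of p "t * m"] by (simp add: field_simps)
qed

section \<open>Weighted differences of polynomial values\<close>

lemma dvd_weighted_difference:
  fixes Q :: "int poly" and d c a :: int
  assumes "d dvd c" and "d dvd Polynomial.coeff Q (N - 1)" and "N > 0"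
  shows "d ^ N dvd (\<Sum>j\<le>N. (- 1) ^ j * int (N choose j) * (2 * (a - int j) + 1)
      * poly Q ((a - int j) * c))"
proof -
  define T where "T k = (\<Sum>j\<le>N. (- 1) ^ j * int (N choose j) * (a - int j) ^ k)" for k
  have T0: "T k = 0" if "k < N" for k
    unfolding T_def using alternating_binomial_power_sum_eq_0[OF that, of a] by simp
  have "(\<Sum>j\<le>N. (- 1) ^ j * int (N choose j) * (2 * (a - int j) + 1) * poly Q ((a - int j) * c))
      = (\<Sum>j\<le>N. \<Sum>r\<le>Polynomial.degree Q. Polynomial.coeff Q r * c ^ r *
          (2 * ((- 1) ^ j * int (N choose j) * (a - int j) ^ Suc r)
            + (- 1) ^ j * int (N choose j) * (a - int j) ^ r))"
    unfolding poly_altdef sum_distrib_left power_mult_distrib power_Suc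
    by (intro sum.cong refl) (simp add: distrib_left distrib_right mult_ac)
  also have "\<dots> = (\<Sum>r\<le>Polynomial.degree Q. Polynomial.coeff Q r * c ^ r * (2 * T (Suc r) + T r))"
    unfolding T_def by (subst sum.swap) (simp only: sum_distrib_left sum.distrib distrib_left)
  also have "d ^ N dvd \<dots>"
  proof (rule dvd_sum)
    fix r
    \<comment> \<open>The weight raises the degree by one, so \<open>r = N - 1\<close> already
      escapes annihilation. There \<open>c ^ r\<close> falls one factor \<open>d\<close> short,
      which the coefficient supplies.\<close>
    consider "Suc r < N" | "Suc r = N" | "N \<le> r" by linarith
    then show "d ^ N dvd Polynomial.coeff Q r * c ^ r * (2 * T (Suc r) + T r)"
    proof cases
      case 1
      then show ?thesis by (simp add: T0)
    next
      case 2
      then have "d * d ^ r dvd Polynomial.coeff Q r * c ^ r"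
        using assms by (intro mult_dvd_mono dvd_power_same) auto
      then show ?thesis using 2 by auto
    next
      case 3
      then have "d ^ N dvd c ^ r" using assms(1) by (metis dvd_power_le)
      then show ?thesis by auto
    qed
  qed
  finally show ?thesis .
qed

text \<open>The \<open>2 * n + 2\<close> indices pair off as \<open>j\<close> and
  \<open>2 * n + 1 - j\<close>, with no index fixed.\<close>

lemma sum_atMost_odd_symmetric:
  fixes f :: "nat \<Rightarrow> 'a :: comm_semiring_1"
  assumes "\<And>j. j \<le> n \<Longrightarrow> f (2 * n + 1 - j) = f j"
  shows "(\<Sum>j\<le>2 * n + 1. f j) = 2 * (\<Sum>j=0..n. f j)"
proof -
  have "{..2 * n + 1} = {0..n} \<union> {n + 1..2 * n + 1}" by auto
  then have "(\<Sum>j\<le>2 * n + 1. f j) = (\<Sum>j=0..n. f j) + (\<Sum>j=n + 1..2 * n + 1. f j)"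
    by (simp add: sum.union_disjoint)
  also have "(\<Sum>j=n + 1..2 * n + 1. f j) = (\<Sum>j=0..n. f j)"
    by (rule sum.reindex_bij_witness[where i = "\<lambda>j. 2 * n + 1 - j" and j = "\<lambda>j. 2 * n + 1 - j"])
       (use assms in \<open>auto simp flip: assms\<close>)
  finally show ?thesis by (simp add: mult_2)
qed

section \<open>Passage from integers to \<open>p\<close>-integral rationals\<close>

lemma p_dvd_if_dvd_numerator:
  assumes "int (p ^ k) dvd a" "\<not> int p dvd b" "of_int b * x = (of_int a :: rat)"
  shows "p_dvd p (of_nat (p ^ k)) x"
proof -
  obtain c where c: "a = int (p ^ k) * c" using assms(1) by auto
  have "b \<noteq> 0" using assms(2) by auto
  then have "x = of_nat (p ^ k) * (of_int c / of_int b)"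
    using assms(3) c by (simp add: field_simps)
  then show ?thesis using assms(2) unfolding p_dvd_def p_integers_def by blast
qed

lemma p_integers_add:
  assumes "prime p" "x \<in> p_integers p" "y \<in> p_integers p"
  shows "x + y \<in> p_integers p"
proof -
  obtain a b c d where *: "x = of_int a / of_int b" "\<not> int p dvd b"
      "y = of_int c / of_int d" "\<not> int p dvd d"
    using assms(2,3) unfolding p_integers_def by blast
  then have "b \<noteq> 0" "d \<noteq> 0" by auto
  then have "x + y = of_int (a * d + c * b) / of_int (b * d)" using * by (simp add: field_simps)
  moreover have "\<not> int p dvd b * d" using * assms(1) by (simp add: prime_dvd_mult_iff)
  ultimately show ?thesis unfolding p_integers_def by blast
qed

lemma p_integers_sum:
  assumes "prime p" "\<And>i. i \<in> A \<Longrightarrow> f i \<in> p_integers p"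
  shows "sum f A \<in> p_integers p"
proof -
  have zero: "0 \<in> p_integers p"
    unfolding p_integers_def mem_Collect_eq
    using assms(1) by (intro exI[of _ 0] exI[of _ 1]) (simp add: prime_nat_iff)
  from assms(2) show ?thesis
  proof (induction A rule: infinite_finite_induct)
    case (insert x A)
    then show ?case using p_integers_add[OF assms(1)] by simp
  qed (simp_all add: zero)
qed

theorem theorem1:
  fixes n m p :: nat
  assumes "n \<ge> 1" and "m \<ge> 1" and "prime p" and "p > 2 * n + 1"
  shows "p_dvd p (of_nat (p ^ ((2 * n + 1) * multiplicity p m)))
    (\<Sum>j = 0..n. (- 1) ^ j * (of_nat ((2 * n + 1) choose j) * of_nat (2 * (n - j) + 1) / of_nat (2 * n + 1))
        * mod_binom p ((n + 1 - j) * m) m)"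
proof (cases "p dvd m")
  case False
  have N: "\<not> p dvd 2 * n + 1" using assms(4) by (auto dest: dvd_imp_le)
  have "(- 1) ^ j * (of_nat ((2 * n + 1) choose j) * of_nat (2 * (n - j) + 1) / of_nat (2 * n + 1))
      * mod_binom p ((n + 1 - j) * m) m \<in> p_integers p" (is "?x \<in> _") for j
  proof -
    \<comment> \<open>All denominators are collected in \<open>?b\<close>; it is prime to
      \<open>p\<close> because \<open>p > 2 * n + 1\<close> and modified factorials omit multiples
      of \<open>p\<close>.\<close>
    let ?b = "(2 * n + 1) * (mod_fact p m * mod_fact p ((n + 1 - j) * m - m))"
    let ?a = "(- 1) ^ j * int (((2 * n + 1) choose j) * (2 * (n - j) + 1) * mod_fact p ((n + 1 - j) * m))"
    have "?x = of_int ?a / of_int (int ?b)" 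
      unfolding mod_binom_def of_int_mult of_int_power of_int_minus of_int_1 of_int_of_nat_eq of_nat_mult
      by simp
    moreover have "\<not> p dvd ?b"
      using N assms(3) by (simp only: prime_dvd_mult_iff not_dvd_mod_fact simp_thms)
    ultimately show ?thesis unfolding p_integers_def mem_Collect_eq
      by (intro exI[of _ ?a] exI[of _ "int ?b"]) (simp only: int_dvd_int_iff simp_thms)
  qed
  then have "(\<Sum>j = 0..n. (- 1) ^ j * (of_nat ((2 * n + 1) choose j) * of_nat (2 * (n - j) + 1) / of_nat (2 * n + 1))
        * mod_binom p ((n + 1 - j) * m) m) \<in> p_integers p" (is "?S \<in> _")
    by (intro p_integers_sum[OF assms(3)])
  moreover have "of_nat (p ^ ((2 * n + 1) * multiplicity p m)) = (1 :: rat)"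
    using False by (simp add: not_dvd_imp_multiplicity_0)
  ultimately show ?thesis unfolding p_dvd_def by (intro bexI[of _ ?S]) simp_all
next
  case True
  define Q where "Q = p_units_poly p m"
  define N where "N = 2 * n + 1"
  define v where "v = multiplicity p m"
  define D where "D = mod_fact p m"
  \<comment> \<open>This is the summand with the denominators \<open>N\<close> and \<open>D\<close>
    cleared. Integer subtraction makes \<open>t = n - j\<close> negative for \<open>j > n\<close>,
    as the full difference requires.\<close>
  define f where "f j = (- 1) ^ j * int (N choose j) * (2 * (int n - int j) + 1)
      * poly Q ((int n - int j) * int m)" for j
  let ?S = "\<Sum>j = 0..n. (- 1) ^ j * (of_nat ((2 * n + 1) choose j) * of_nat (2 * (n - j) + 1) / of_nat (2 * n + 1))
        * mod_binom p ((n + 1 - j) * m) m"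
  have "odd p" using assms prime_odd_nat[of p] by auto
  have "int (p ^ v) ^ N dvd (\<Sum>j\<le>N. f j)"
    unfolding f_def
  proof (rule dvd_weighted_difference)
    show "int (p ^ v) dvd int m" unfolding v_def int_dvd_int_iff by (rule multiplicity_dvd)
    \<comment> \<open>The bounds on \<open>n\<close> and \<open>p\<close> give
      \<open>0 < 2 * n < p - 1\<close>.\<close>
    show "int (p ^ v) dvd Polynomial.coeff Q (N - 1)"
      unfolding v_def Q_def N_def
      using prime_power_dvd_coeff_p_units_poly[of p m "2 * n"] True assms by simp
  qed (simp add: N_def)
  then have dvd: "int (p ^ (N * v)) dvd (\<Sum>j\<le>N. f j)"
    by (simp add: power_mult[symmetric] mult.commute)
  \<comment> \<open>Here \<open>t\<close> becomes \<open>- 1 - t\<close>: the value of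
    \<open>Q\<close> stays, while the sign (as \<open>N\<close> is odd) and the weight
    \<open>2 * t + 1\<close> both flip.\<close>
  have sym: "f (2 * n + 1 - j) = f j" if "j \<le> n" for j
  proof -
    have e: "int n - int (N - j) = - (int n - int j) - 1"
      using that by (simp add: N_def of_nat_diff)
    have "poly Q ((- (int n - int j) - 1) * int m) = poly Q ((int n - int j) * int m)"
      using poly_p_units_poly_reflect[OF True \<open>odd p\<close>, of "(int n - int j) * int m"]
      by (simp add: Q_def algebra_simps)
    moreover have "N choose (N - j) = N choose j"
      using that binomial_symmetric[of j N] by (simp add: N_def)
    moreover have "(- 1 :: int) ^ (N - j) = - ((- 1) ^ j)"
      using that by (auto simp: N_def minus_one_power_iff)
    moreover have "2 * (- (int n - int j) - 1) + 1 = - (2 * (int n - int j) + 1)" by simp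
    ultimately show ?thesis unfolding f_def N_def[symmetric] e
      by (simp only: mult_minus_left mult_minus_right minus_minus)
  qed
  have total: "(\<Sum>j\<le>N. f j) = 2 * (\<Sum>j=0..n. f j)"
    unfolding N_def by (rule sum_atMost_odd_symmetric) (rule sym)
  have "of_nat (N * D) * ?S = (\<Sum>j=0..n. of_int (f j))"
    unfolding sum_distrib_left
  proof (intro sum.cong refl)
    fix j assume "j \<in> {0..n}"
    then have j: "j \<le> n" by simp
    have binom: "mod_binom p ((n + 1 - j) * m) m = of_int (poly Q ((int n - int j) * int m)) / of_nat D"
      using mod_binom_eq_poly[OF True, of "n - j"] j by (simp add: Q_def D_def of_nat_diff Suc_diff_le)
    have pos: "D > 0" "N > 0" by (simp_all add: D_def N_def mod_fact_pos)
    have weight: "of_nat (2 * (n - j) + 1) = (of_int (2 * (int n - int j) + 1) :: rat)"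
      using j by (simp add: of_nat_diff)
    show "of_nat (N * D) * ((- 1) ^ j * (of_nat ((2 * n + 1) choose j) * of_nat (2 * (n - j) + 1) / of_nat (2 * n + 1))
        * mod_binom p ((n + 1 - j) * m) m) = of_int (f j)"
      unfolding f_def N_def[symmetric] binom weight of_int_mult of_int_power of_int_minus of_int_1
        of_int_of_nat_eq of_nat_mult
      using pos by simp
  qed
  then have eq: "of_int (int (2 * (N * D))) * ?S = of_int (\<Sum>j\<le>N. f j)"
    by (simp add: total algebra_simps)
  \<comment> \<open>The factor 2 comes from doubling the half sum; \<open>p\<close> is larger than
    both 2 and \<open>N\<close>.\<close>
  have "\<not> p dvd 2 * (N * D)"
  proof -
    have "\<not> p dvd 2" using assms by (auto dest: dvd_imp_le)
    moreover have "\<not> p dvd N" using assms by (auto simp: N_def dest: dvd_imp_le)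
    ultimately show ?thesis
      using not_dvd_mod_fact[OF assms(3)] assms(3) by (simp add: D_def prime_dvd_mult_iff)
  qed
  then have "\<not> int p dvd int (2 * (N * D))" by (simp only: int_dvd_int_iff not_False_eq_True)
  from p_dvd_if_dvd_numerator[OF dvd this eq] show ?thesis
    unfolding N_def v_def .
qed

end
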